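(* Let $V$ be an optimal prefix-free machine, and for real $T>0$ let $\Theta_V(T)=\sum_{s\in\{0,1\}^*,\,H_V(s)<|s|}2^{-|s|/T}$. For every $T\in(0,1)$, if $\Theta_V(T)$ is right-computable, then $T$ is also right-computable.
   Context: $\{0,1\}^*$ is the set of finite binary strings; $|s|$ is the length of $s$. A prefix-free machine is a partial recursive function $C:\{0,1\}^*\to\{0,1\}^*$ whose domain is prefix-free. $H_C(s)=\min\{|p| : C(p)=s\}$ (possibly $\infty$). A prefix-free machine $V$ is optimal if for every prefix-free machine $C$ there is $d\in\mathbb{N}$ such that for every $p\in\mathrm{Dom}\,C$ there is $q\in\mathrm{Dom}\,V$ with $V(q)=C(p)$ and $|q|\le|p|+d$. A real $\alpha$ is right-computable if there is a total recursive $f:\mathbb{N}^+\to\mathbb{Q}$ with $\alpha\le f(n)$ for all $n$ and $\lim_n f(n)=\alpha$. *)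

theory Defs
  imports "HOL-Analysis.Analysis" "HOL-Library.Extended_Nat" "HOL-Library.Sublist"
begin

datatype recf = Z | S | Proj nat | Comp recf "recf list" | Prim recf recf | Mn recf

inductive eval :: "recf \<Rightarrow> nat list \<Rightarrow> nat \<Rightarrow> bool" where
  eval_Z: "eval Z xs 0"
| eval_S: "eval S (x # xs) (Suc x)"
| eval_Proj: "i < length xs \<Longrightarrow> eval (Proj i) xs (xs ! i)"
| eval_Comp: "list_all2 (\<lambda>g y. eval g xs y) gs ys \<Longrightarrow> eval f ys z \<Longrightarrow> eval (Comp f gs) xs z"
| eval_Prim0: "eval g xs y \<Longrightarrow> eval (Prim g h) (0 # xs) y"
| eval_PrimS: "eval (Prim g h) (n # xs) v \<Longrightarrow> eval h (n # v # xs) y \<Longrightarrow>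
                 eval (Prim g h) (Suc n # xs) y"
| eval_Mn: "eval f (y # xs) 0 \<Longrightarrow> (\<forall>z<y. \<exists>v. eval f (z # xs) (Suc v)) \<Longrightarrow> eval (Mn f) xs y"

definition total_recursive :: "(nat \<Rightarrow> nat) \<Rightarrow> bool" where
  "total_recursive f \<longleftrightarrow> (\<exists>r. \<forall>x y. eval r [x] y \<longleftrightarrow> y = f x)"

text \<open>Computable bijection between binary strings and nat (bijective base 2).\<close>
fun str_to_nat :: "bool list \<Rightarrow> nat" where
  "str_to_nat [] = 0"
| "str_to_nat (b # bs) = 2 * str_to_nat bs + (if b then 2 else 1)"

definition partial_recursive_str :: "(bool list \<Rightarrow> bool list option) \<Rightarrow> bool" where
  "partial_recursive_str C \<longleftrightarrow>
     (\<exists>r. \<forall>p y. eval r [str_to_nat p] y \<longleftrightarrow> (\<exists>s. C p = Some s \<and> y = str_to_nat s))"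

definition prefix_free :: "bool list set \<Rightarrow> bool" where
  "prefix_free A \<longleftrightarrow> (\<forall>p\<in>A. \<forall>q\<in>A. prefix p q \<longrightarrow> p = q)"

definition prefix_free_machine :: "(bool list \<Rightarrow> bool list option) \<Rightarrow> bool" where
  "prefix_free_machine C \<longleftrightarrow> partial_recursive_str C \<and> prefix_free (dom C)"

text \<open>H_C(s) = min{|p| : C(p) = s}, infinity if no such p.\<close>
definition H :: "(bool list \<Rightarrow> bool list option) \<Rightarrow> bool list \<Rightarrow> enat" where
  "H C s = (INF p\<in>{p. C p = Some s}. enat (length p))"

definition optimal :: "(bool list \<Rightarrow> bool list option) \<Rightarrow> bool" where
  "optimal V \<longleftrightarrow> prefix_free_machine V \<and>
     (\<forall>C. prefix_free_machine C \<longrightarrow>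
        (\<exists>d::nat. \<forall>p\<in>dom C. \<exists>q\<in>dom V. V q = C p \<and> length q \<le> length p + d))"

text \<open>A total recursive f : N+ -> Q is represented by three total recursive functions
  a, b, c : nat -> nat via f(n) = (a n - b n) / (c n + 1).\<close>
definition right_computable :: "real \<Rightarrow> bool" where
  "right_computable \<alpha> \<longleftrightarrow>
     (\<exists>a b c. total_recursive a \<and> total_recursive b \<and> total_recursive c \<and>
        (let f = (\<lambda>n. (real (a n) - real (b n)) / (real (c n) + 1)) in
          (\<forall>n\<ge>1. \<alpha> \<le> f n) \<and> f \<longlonglongrightarrow> \<alpha>))"

definition Theta :: "(bool list \<Rightarrow> bool list option) \<Rightarrow> real \<Rightarrow> real" where
  "Theta V T = infsum (\<lambda>s. 2 powr (- real (length s) / T)) {s. H V s < enat (length s)}"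

end

theory Submission
  imports Defs
begin

text \<open>
  The map \<open>t \<mapsto> \<Theta>(t)\<close> is strictly increasing, as an optimal machine compresses at least one string,
  and \<open>\<Theta>(T)\<close> is finite for \<open>T < 1\<close> by the Kraft inequality. Enumerating the compressible strings for
  \<open>m\<close> stages and rounding each of their weights down to a multiple of \<open>1 / (m + 1)\<close> gives a
  computable lower approximation \<open>g m t\<close> of \<open>\<Theta>(t)\<close> for rational \<open>t\<close>. Let \<open>f m\<close> be computable
  upper approximations of \<open>\<Theta>(T)\<close>. Then \<open>g m t \<le> f m\<close> for every \<open>t \<le> T\<close> and every \<open>m\<close>, whereas for each
  \<open>t\<^sub>0 > T\<close> and all large \<open>m\<close> one has \<open>g m t > f m\<close> for all \<open>t \<ge> t\<^sub>0\<close>. Hence the proportion of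
  those \<open>t\<close> among \<open>0, 1 / (m + 1), \<dots>, m / (m + 1)\<close> with \<open>g m t \<le> f m\<close> converges to \<open>T\<close> from above.
\<close>

section \<open>Total recursive functions of several arguments\<close>

text \<open>One equivalence expresses existence and uniqueness of the value, on argument lists of
  length \<open>n\<close> only. Predicates are handled through their \<open>of_bool\<close>
  values.\<close>

definition recfn :: "nat \<Rightarrow> (nat list \<Rightarrow> nat) \<Rightarrow> bool" where
  "recfn n F \<longleftrightarrow> (\<exists>r. \<forall>xs. length xs = n \<longrightarrow> (\<forall>y. eval r xs y \<longleftrightarrow> y = F xs))"

inductive_simps eval_Z_iff: "eval Z xs y"
inductive_simps eval_S_iff: "eval S xs y"
inductive_simps eval_Proj_iff: "eval (Proj i) xs y"
inductive_simps eval_Comp_iff: "eval (Comp f gs) xs y"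
inductive_simps eval_Prim_0_iff: "eval (Prim g h) (0 # xs) y"
inductive_simps eval_Prim_Suc_iff: "eval (Prim g h) (Suc n # xs) y"
inductive_simps eval_Prim_Nil_iff: "eval (Prim g h) [] y"
inductive_simps eval_Mn_iff: "eval (Mn f) xs y"

lemma total_recursive_iff_recfn: "total_recursive f \<longleftrightarrow> recfn 1 (\<lambda>xs. f (xs ! 0))"
  unfolding total_recursive_def recfn_def
  by (auto simp: length_Suc_conv intro!: arg_cong[where f = Ex] ext)

lemma recfn_cong:
  assumes "\<And>xs. length xs = n \<Longrightarrow> F xs = G xs"
  shows "recfn n F \<longleftrightarrow> recfn n G"
  unfolding recfn_def using assms by simp

lemma recfn_nth: "i < n \<Longrightarrow> recfn n (\<lambda>xs. xs ! i)"
  unfolding recfn_def by (rule exI[of _ "Proj i"]) (auto simp: eval_Proj_iff)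

lemma recfn_comp:
  assumes f: "recfn (length gs) f" and gs: "\<forall>g\<in>set gs. recfn n g"
  shows "recfn n (\<lambda>xs. f (map (\<lambda>g. g xs) gs))"
proof -
  obtain r where r: "\<And>xs y. length xs = length gs \<Longrightarrow> eval r xs y \<longleftrightarrow> y = f xs"
    using f unfolding recfn_def by blast
  from gs obtain R where R: "\<And>g xs y. g \<in> set gs \<Longrightarrow> length xs = n \<Longrightarrow> eval (R g) xs y \<longleftrightarrow> y = g xs"
    unfolding recfn_def by (auto dest!: bchoice)
  have *: "list_all2 (\<lambda>g y. eval g xs y) (map R gs) ys \<longleftrightarrow> ys = map (\<lambda>g. g xs) gs"
    if "length xs = n" for xs ys
    using that by (auto simp: list_all2_conv_all_nth list_eq_iff_nth_eq R)
  show ?thesis unfolding recfn_def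
    by (rule exI[of _ "Comp r (map R gs)"]) (auto simp: eval_Comp_iff * r)
qed

text \<open>The kept arguments are projections with index in \<open>[k..<n]\<close>, so
  \<open>recfn_comp\<close> applies. This serves to prepend or rearrange leading arguments when the
  arity is a variable.\<close>

lemma recfn_comp_drop:
  assumes "recfn (length gs + (n - k)) f" "\<forall>g\<in>set gs. recfn n g"
  shows "recfn n (\<lambda>xs. f (map (\<lambda>g. g xs) gs @ drop k xs))"
proof -
  have "recfn n (\<lambda>xs. f (map (\<lambda>g. g xs) (gs @ map (\<lambda>i xs. xs ! i) [k..<n])))"
    by (rule recfn_comp) (use assms in \<open>auto intro: recfn_nth\<close>)
  moreover have "map (\<lambda>i. xs ! i) [k..<n] = drop k xs" if "length xs = n" for xs :: "nat list"
    using that by (auto intro: nth_equalityI)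
  ultimately show ?thesis
    by (subst recfn_cong[where G = "\<lambda>xs. f (map (\<lambda>g. g xs) (gs @ map (\<lambda>i xs. xs ! i) [k..<n]))"])
       (simp_all add: comp_def)
qed

lemma recfn_comp1:
  assumes "recfn 1 (\<lambda>xs. f (xs ! 0))" "recfn n A"
  shows "recfn n (\<lambda>xs. f (A xs))"
  using recfn_comp[of "[A]" "\<lambda>xs. f (xs ! 0)" n] assms by simp

lemma recfn_comp2:
  assumes "recfn 2 (\<lambda>xs. f (xs ! 0) (xs ! 1))" "recfn n A" "recfn n B"
  shows "recfn n (\<lambda>xs. f (A xs) (B xs))"
  using recfn_comp[of "[A, B]" "\<lambda>xs. f (xs ! 0) (xs ! 1)" n] assms
  by (simp add: numeral_2_eq_2)

lemma recfn_Suc: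
  assumes "recfn n A"
  shows "recfn n (\<lambda>xs. Suc (A xs))"
proof -
  have "recfn 1 (\<lambda>xs. Suc (xs ! 0))"
    unfolding recfn_def by (rule exI[of _ S]) (auto simp: eval_S_iff length_Suc_conv)
  from recfn_comp1[OF this assms] show ?thesis .
qed

lemma recfn_const: "recfn n (\<lambda>_. c)"
proof (induction c)
  case 0
  show ?case unfolding recfn_def by (rule exI[of _ Z]) (auto simp: eval_Z_iff)
qed (rule recfn_Suc)

lemma recfn_prim:
  assumes "recfn n g" "recfn (Suc (Suc n)) h"
  shows "recfn (Suc n) (\<lambda>ys. rec_nat (g (tl ys)) (\<lambda>j u. h (j # u # tl ys)) (hd ys))"
proof -
  obtain rg where rg: "\<And>xs y. length xs = n \<Longrightarrow> eval rg xs y \<longleftrightarrow> y = g xs"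
    using assms(1) unfolding recfn_def by blast
  obtain rh where rh: "\<And>xs y. length xs = Suc (Suc n) \<Longrightarrow> eval rh xs y \<longleftrightarrow> y = h xs"
    using assms(2) unfolding recfn_def by blast
  have "eval (Prim rg rh) (m # xs) y \<longleftrightarrow> y = rec_nat (g xs) (\<lambda>j u. h (j # u # xs)) m"
    if "length xs = n" for m xs y
    using that by (induction m arbitrary: y) (auto simp: eval_Prim_0_iff eval_Prim_Suc_iff rg rh)
  then show ?thesis unfolding recfn_def
    by (intro exI[of _ "Prim rg rh"]) (auto simp: length_Suc_conv)
qed

section \<open>Arithmetic by primitive recursion\<close>

lemma recfn_add:
  assumes "recfn n A" "recfn n B"
  shows "recfn n (\<lambda>xs. A xs + B xs)"
proof -
  have *: "rec_nat x (\<lambda>j u. Suc u) k = k + x" for x k :: nat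
    by (induction k) auto
  have "recfn (Suc 1) (\<lambda>ys. rec_nat (tl ys ! 0) (\<lambda>j u. Suc ((j # u # tl ys) ! 1)) (hd ys))"
    by (rule recfn_prim[where g = "\<lambda>xs. xs ! 0" and h = "\<lambda>xs. Suc (xs ! 1)"])
       (auto intro!: recfn_Suc recfn_nth)
  then have "recfn 2 (\<lambda>xs. xs ! 0 + xs ! 1)"
    by (subst recfn_cong[where G = "\<lambda>ys. rec_nat (tl ys ! 0) (\<lambda>j u. Suc ((j # u # tl ys) ! 1)) (hd ys)"])
       (auto simp: * length_Suc_conv numeral_2_eq_2)
  from recfn_comp2[OF this assms] show ?thesis .
qed

lemma recfn_mult:
  assumes "recfn n A" "recfn n B"
  shows "recfn n (\<lambda>xs. A xs * B xs)"
proof -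
  have *: "rec_nat 0 (\<lambda>j u. u + x) k = k * x" for x k :: nat
    by (induction k) auto
  have "recfn (Suc 1) (\<lambda>ys. rec_nat 0 (\<lambda>j u. (j # u # tl ys) ! 1 + (j # u # tl ys) ! 2) (hd ys))"
    by (rule recfn_prim[where g = "\<lambda>xs. 0" and h = "\<lambda>xs. xs ! 1 + xs ! 2"])
       (auto intro!: recfn_add recfn_const recfn_nth)
  then have "recfn 2 (\<lambda>xs. xs ! 0 * xs ! 1)"
    by (subst recfn_cong[where G = "\<lambda>ys. rec_nat 0 (\<lambda>j u. (j # u # tl ys) ! 1 + (j # u # tl ys) ! 2) (hd ys)"])
       (auto simp: * length_Suc_conv numeral_2_eq_2)
  from recfn_comp2[OF this assms] show ?thesis .
qed

lemma recfn_power: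
  assumes "recfn n A" "recfn n B"
  shows "recfn n (\<lambda>xs. A xs ^ B xs)"
proof -
  have *: "rec_nat (Suc 0) (\<lambda>j u. u * x) k = x ^ k" for x k :: nat
    by (induction k) auto
  have "recfn (Suc 1) (\<lambda>ys. rec_nat 1 (\<lambda>j u. (j # u # tl ys) ! 1 * (j # u # tl ys) ! 2) (hd ys))"
    by (rule recfn_prim[where g = "\<lambda>xs. 1" and h = "\<lambda>xs. xs ! 1 * xs ! 2"])
       (auto intro!: recfn_mult recfn_const recfn_nth)
  \<comment> \<open>Recursion runs on the head of the list, so the exponent stands first;
    \<open>assms(2,1)\<close> restores the order.\<close>
  then have "recfn 2 (\<lambda>xs. xs ! 1 ^ xs ! 0)"
    by (subst recfn_cong[where G = "\<lambda>ys. rec_nat 1 (\<lambda>j u. (j # u # tl ys) ! 1 * (j # u # tl ys) ! 2) (hd ys)"])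
       (auto simp: * length_Suc_conv numeral_2_eq_2)
  from recfn_comp2[OF this assms(2,1)] show ?thesis .
qed

lemma recfn_pred:
  assumes "recfn n A"
  shows "recfn n (\<lambda>xs. A xs - 1)"
proof -
  have *: "rec_nat 0 (\<lambda>j u. j) k = k - 1" for k :: nat
    by (cases k) auto
  have "recfn (Suc 0) (\<lambda>ys. rec_nat 0 (\<lambda>j u. (j # u # tl ys) ! 0) (hd ys))"
    by (rule recfn_prim[where g = "\<lambda>xs. 0" and h = "\<lambda>xs. xs ! 0"])
       (auto intro!: recfn_const recfn_nth)
  then have "recfn 1 (\<lambda>xs. xs ! 0 - 1)"
    by (subst recfn_cong[where G = "\<lambda>ys. rec_nat 0 (\<lambda>j u. (j # u # tl ys) ! 0) (hd ys)"])
       (auto simp: * length_Suc_conv)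
  from recfn_comp1[OF this assms] show ?thesis .
qed

lemma recfn_diff:
  assumes "recfn n A" "recfn n B"
  shows "recfn n (\<lambda>xs. A xs - B xs)"
proof -
  have *: "rec_nat x (\<lambda>j u. u - Suc 0) k = x - k" for x k :: nat
    by (induction k) auto
  have "recfn (Suc 1) (\<lambda>ys. rec_nat (tl ys ! 0) (\<lambda>j u. (j # u # tl ys) ! 1 - 1) (hd ys))"
    by (rule recfn_prim[where g = "\<lambda>xs. xs ! 0" and h = "\<lambda>xs. xs ! 1 - 1"])
       (intro recfn_pred recfn_nth; simp)+
  then have "recfn 2 (\<lambda>xs. xs ! 1 - xs ! 0)"
    by (subst recfn_cong[where G = "\<lambda>ys. rec_nat (tl ys ! 0) (\<lambda>j u. (j # u # tl ys) ! 1 - 1) (hd ys)"])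
       (auto simp: * length_Suc_conv numeral_2_eq_2)
  from recfn_comp2[OF this assms(2,1)] show ?thesis .
qed

section \<open>Decidable predicates, bounded sums and bounded quantifiers\<close>

lemma recfn_not:
  assumes "recfn n (\<lambda>xs. of_bool (P xs))"
  shows "recfn n (\<lambda>xs. of_bool (\<not> P xs))"
proof -
  have "(1::nat) - of_bool p = of_bool (\<not> p)" for p
    by simp
  with recfn_diff[OF recfn_const[of n 1] assms] show ?thesis by (simp only:)
qed

lemma recfn_conj:
  assumes "recfn n (\<lambda>xs. of_bool (P xs))" "recfn n (\<lambda>xs. of_bool (Q xs))"
  shows "recfn n (\<lambda>xs. of_bool (P xs \<and> Q xs))"
  using recfn_mult[OF assms] by (simp add: of_bool_conj)

lemma recfn_le:
  assumes "recfn n A" "recfn n B"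
  shows "recfn n (\<lambda>xs. of_bool (A xs \<le> B xs))"
proof -
  have "recfn n (\<lambda>xs. 1 - (A xs - B xs))"
    by (intro recfn_diff recfn_const assms)
  moreover have "1 - (a - b) = of_bool (a \<le> b)" for a b :: nat
    by auto
  ultimately show ?thesis by (simp only:)
qed

lemma recfn_less:
  assumes "recfn n A" "recfn n B"
  shows "recfn n (\<lambda>xs. of_bool (A xs < B xs))"
  using recfn_not[OF recfn_le[OF assms(2,1)]] by (simp add: not_le)

lemma recfn_eq:
  assumes "recfn n A" "recfn n B"
  shows "recfn n (\<lambda>xs. of_bool (A xs = B xs))"
  using recfn_conj[OF recfn_le[OF assms] recfn_le[OF assms(2,1)]]
  by (simp add: order_eq_iff)

lemma recfn_If:
  assumes "recfn n (\<lambda>xs. of_bool (P xs))" "recfn n A" "recfn n B"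
  shows "recfn n (\<lambda>xs. if P xs then A xs else B xs)"
proof -
  have "recfn n (\<lambda>xs. of_bool (P xs) * A xs + of_bool (\<not> P xs) * B xs)"
    by (intro recfn_add recfn_mult recfn_not assms)
  moreover have "of_bool p * a + of_bool (\<not> p) * b = (if p then a else b)" for p and a b :: nat
    by auto
  ultimately show ?thesis by (simp only:)
qed

text \<open>Primitive recursion on the upper bound. The summation index becomes the head of the
  list, which shifts all other arguments by one position.\<close>

lemma recfn_sum:
  assumes F: "recfn (Suc n) F" and B: "recfn n B"
  shows "recfn n (\<lambda>xs. \<Sum>i<B xs. F (i # xs))"
proof -
  have *: "rec_nat 0 (\<lambda>j u. u + f j) k = (\<Sum>i<k. f i)" for f :: "nat \<Rightarrow> nat" and k
    by (induction k) auto
  have "recfn (Suc (Suc n)) (\<lambda>xs. F (xs ! 0 # drop 2 xs))"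
    using recfn_comp_drop[of "[\<lambda>xs. xs ! 0]" "Suc (Suc n)" 2 F] F by (simp add: recfn_nth)
  then have "recfn (Suc n) (\<lambda>ys. rec_nat 0 (\<lambda>j u. (j # u # tl ys) ! 1 +
      F ((j # u # tl ys) ! 0 # drop 2 (j # u # tl ys))) (hd ys))"
    by (intro recfn_prim[where g = "\<lambda>_. 0" and
        h = "\<lambda>xs. xs ! 1 + F (xs ! 0 # drop 2 xs)"] recfn_const recfn_add recfn_nth) auto
  then have "recfn (Suc n) (\<lambda>ys. \<Sum>i<hd ys. F (i # tl ys))"
    by (simp add: *)
  then have "recfn n (\<lambda>xs. \<Sum>i<hd (map (\<lambda>g. g xs) [B] @ drop 0 xs).
      F (i # tl (map (\<lambda>g. g xs) [B] @ drop 0 xs)))"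
    by (intro recfn_comp_drop) (auto simp: B)
  then show ?thesis by simp
qed

lemmas recfn_intros = recfn_const recfn_nth recfn_add recfn_mult recfn_power recfn_diff
  recfn_not recfn_conj recfn_le recfn_less recfn_eq recfn_If

text \<open>The number of counterexamples is a bounded sum and can be compared with 0.\<close>

lemma recfn_Ball_less:
  assumes P: "recfn (Suc n) (\<lambda>ys. of_bool (P ys))" and B: "recfn n B"
  shows "recfn n (\<lambda>xs. of_bool (\<forall>i<B xs. P (i # xs)))"
proof -
  have "recfn n (\<lambda>xs. of_bool ((\<Sum>i<B xs. of_bool (\<not> P (i # xs))) = (0::nat)))"
    by (intro recfn_eq recfn_const recfn_sum[OF recfn_not[OF P] B])
  moreover have "((\<Sum>i<B xs. of_bool (\<not> P (i # xs))) = (0::nat)) \<longleftrightarrow> (\<forall>i<B xs. P (i # xs))" for xs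
    by auto
  ultimately show ?thesis by (simp only:)
qed

lemma recfn_Ball_list:
  assumes "\<forall>g\<in>set gs. recfn n (\<lambda>xs. of_bool (P g xs))"
  shows "recfn n (\<lambda>xs. of_bool (\<forall>g\<in>set gs. P g xs))"
  using assms
proof (induction gs)
  case Nil
  then show ?case using recfn_const[of n 1] by simp
next
  case (Cons a gs)
  then have "recfn n (\<lambda>xs. of_bool (P a xs \<and> (\<forall>g\<in>set gs. P g xs)))"
    by (intro recfn_conj) auto
  then show ?case by simp
qed

section \<open>Computation stages of partial recursive functions\<close>

text \<open>\<open>F (k # xs) = Suc y\<close> says that stage \<open>k\<close> of the computation of \<open>r\<close> on \<open>xs\<close> has output \<open>y\<close>, and
  \<open>F (k # xs) = 0\<close> that it has none yet. Asking only for eventual correctness makes monotonicity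
  in \<open>k\<close> unnecessary.\<close>

definition stages :: "recf \<Rightarrow> nat \<Rightarrow> (nat list \<Rightarrow> nat) \<Rightarrow> bool" where
  "stages r n F \<longleftrightarrow> recfn (Suc n) F \<and> (\<forall>xs y. length xs = n \<longrightarrow>
     (\<forall>k. F (k # xs) = Suc y \<longrightarrow> eval r xs y) \<and>
     (eval r xs y \<longrightarrow> (\<forall>\<^sub>F k in sequentially. F (k # xs) = Suc y)))"

lemma stagesI:
  assumes "recfn (Suc n) F"
    and "\<And>xs k y. length xs = n \<Longrightarrow> F (k # xs) = Suc y \<Longrightarrow> eval r xs y"
    and "\<And>xs y. length xs = n \<Longrightarrow> eval r xs y \<Longrightarrow> \<forall>\<^sub>F k in sequentially. F (k # xs) = Suc y"
  shows "stages r n F"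
  using assms unfolding stages_def by blast

lemma stagesD:
  assumes "stages r n F"
  shows "recfn (Suc n) F"
    and "\<And>xs k y. F (k # xs) = Suc y \<Longrightarrow> length xs = n \<Longrightarrow> eval r xs y"
    and "\<And>xs y. eval r xs y \<Longrightarrow> length xs = n \<Longrightarrow> \<forall>\<^sub>F k in sequentially. F (k # xs) = Suc y"
  using assms unfolding stages_def by blast+

text \<open>The outer function is consulted only when every inner stage has an output. If the
  finitely many inner values exist, all are correct from some stage on.\<close>

lemma stages_Comp:
  assumes f: "stages f (length gs) F" and gs: "\<forall>g\<in>set gs. stages g n (G g)"
  shows "stages (Comp f gs) n (\<lambda>ys. if \<forall>g\<in>set gs. 0 < G g ys
           then F (ys ! 0 # map (\<lambda>g. G g ys - 1) gs) else 0)"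
proof (rule stagesI)
  have "recfn (Suc n) (\<lambda>ys. F (map (\<lambda>g. g ys) ((\<lambda>ys. ys ! 0) # map (\<lambda>g ys. G g ys - 1) gs)))"
    using stagesD(1)[OF f] gs
    by (intro recfn_comp) (auto intro!: recfn_nth recfn_diff recfn_const dest: stagesD(1))
  then have "recfn (Suc n) (\<lambda>ys. F (ys ! 0 # map (\<lambda>g. G g ys - 1) gs))"
    by (simp add: comp_def)
  then show "recfn (Suc n) (\<lambda>ys. if \<forall>g\<in>set gs. 0 < G g ys
           then F (ys ! 0 # map (\<lambda>g. G g ys - 1) gs) else 0)"
    using gs by (intro recfn_If recfn_Ball_list recfn_const) (auto intro!: recfn_less recfn_const dest: stagesD(1))
next
  fix xs k y assume xs: "length xs = n"
    and eq: "(if \<forall>g\<in>set gs. 0 < G g (k # xs)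
           then F ((k # xs) ! 0 # map (\<lambda>g. G g (k # xs) - 1) gs) else 0) = Suc y"
  then have pos: "\<forall>g\<in>set gs. 0 < G g (k # xs)"
    and "F (k # map (\<lambda>g. G g (k # xs) - 1) gs) = Suc y"
    by (auto split: if_splits)
  then have "eval f (map (\<lambda>g. G g (k # xs) - 1) gs) y"
    using stagesD(2)[OF f] by simp
  moreover have "eval g xs (G g (k # xs) - 1)" if "g \<in> set gs" for g
    using stagesD(2)[of g n "G g" k xs "G g (k # xs) - 1"] gs pos that xs by auto
  then have "list_all2 (\<lambda>g y. eval g xs y) gs (map (\<lambda>g. G g (k # xs) - 1) gs)"
    by (simp add: list_all2_conv_all_nth)
  ultimately show "eval (Comp f gs) xs y"
    by (auto simp: eval_Comp_iff)
next
  fix xs y assume xs: "length xs = n" and "eval (Comp f gs) xs y"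
  then obtain zs where zs: "list_all2 (\<lambda>g y. eval g xs y) gs zs" and y: "eval f zs y"
    by (auto simp: eval_Comp_iff)
  from zs have len: "length zs = length gs" by (simp add: list_all2_lengthD)
  have "\<forall>\<^sub>F k in sequentially. \<forall>i\<in>{..<length gs}. G (gs ! i) (k # xs) = Suc (zs ! i)"
  proof (rule eventually_ball_finite)
    show "\<forall>i\<in>{..<length gs}. \<forall>\<^sub>F k in sequentially. G (gs ! i) (k # xs) = Suc (zs ! i)"
      using zs gs xs by (auto simp: list_all2_conv_all_nth intro!: stagesD(3))
  qed simp
  moreover have "\<forall>\<^sub>F k in sequentially. F (k # zs) = Suc y"
    by (rule stagesD(3)[OF f y len])
  ultimately show "\<forall>\<^sub>F k in sequentially. (if \<forall>g\<in>set gs. 0 < G g (k # xs)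
           then F ((k # xs) ! 0 # map (\<lambda>g. G g (k # xs) - 1) gs) else 0) = Suc y"
  proof eventually_elim
    case (elim k)
    then have "map (\<lambda>g. G g (k # xs) - 1) gs = zs"
      using len by (auto intro: nth_equalityI)
    moreover have "\<forall>g\<in>set gs. 0 < G g (k # xs)"
      using elim(1) by (auto simp: in_set_conv_nth)
    ultimately show ?case using elim(2) by simp
  qed
qed

text \<open>All levels of the recursion use the same stage \<open>k\<close>, and 0 is passed on
  while a value is missing. Eventual correctness follows by induction on the recursion
  argument.\<close>

lemma stages_Prim:
  assumes g: "stages g n G" and h: "stages h (Suc (Suc n)) F"
  shows "stages (Prim g h) (Suc n) (\<lambda>ys. rec_nat (G (ys ! 0 # drop 2 ys))
           (\<lambda>j u. if u = 0 then 0 else F (ys ! 0 # j # (u - 1) # drop 2 ys)) (ys ! 1))"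
    (is "stages _ _ ?R")
proof (rule stagesI)
  \<comment> \<open>The list is \<open>j # u # k # xs\<close>: the recursion puts its own variables
    in front, while \<open>F\<close> takes the stage first.\<close>
  have "recfn (Suc (Suc (Suc n))) (\<lambda>zs. F (map (\<lambda>g. g zs) [\<lambda>zs. zs ! 2, \<lambda>zs. zs ! 0, \<lambda>zs. zs ! 1 - 1] @ drop 3 zs))"
    by (rule recfn_comp_drop) (use stagesD(1)[OF h] in \<open>auto intro!: recfn_nth recfn_pred[unfolded One_nat_def]\<close>)
  then have "recfn (Suc (Suc (Suc n))) (\<lambda>zs. if zs ! 1 = 0 then 0
       else F (zs ! 2 # zs ! 0 # (zs ! 1 - 1) # drop 3 zs))"
    by (intro recfn_If recfn_eq recfn_const recfn_nth) auto
  from recfn_prim[OF stagesD(1)[OF g] this]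
  have "recfn (Suc (Suc n)) (\<lambda>ys. rec_nat (G (tl ys)) (\<lambda>j u. if u = 0 then 0
       else F (hd (tl ys) # j # (u - 1) # tl (tl ys))) (hd ys))"
    by (rule recfn_cong[THEN iffD1, rotated])
       (auto simp: length_Suc_conv numeral_2_eq_2 numeral_3_eq_3 intro!: arg_cong2[where f = "\<lambda>a b. rec_nat a b _"] ext)
  then have "recfn (Suc (Suc n)) (\<lambda>ys. (\<lambda>ys. rec_nat (G (tl ys)) (\<lambda>j u. if u = 0 then 0
       else F (hd (tl ys) # j # (u - 1) # tl (tl ys))) (hd ys)) (map (\<lambda>g. g ys) [\<lambda>ys. ys ! 1, \<lambda>ys. ys ! 0] @ drop 2 ys))"
    by (intro recfn_comp_drop) (auto intro!: recfn_nth)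
  then show "recfn (Suc (Suc n)) ?R" by (simp cong: if_cong)
next
  fix ys k y assume "length ys = Suc n" and eq: "?R (k # ys) = Suc y"
  then obtain m xs where ys: "ys = m # xs" "length xs = n" by (auto simp: length_Suc_conv)
  have "rec_nat (G (k # xs)) (\<lambda>j u. if u = 0 then 0 else F (k # j # (u - 1) # xs)) m = Suc y
     \<Longrightarrow> eval (Prim g h) (m # xs) y"
  proof (induction m arbitrary: y)
    case 0
    then show ?case using stagesD(2)[OF g] ys by (auto simp: eval_Prim_0_iff)
  next
    case (Suc m)
    let ?u = "rec_nat (G (k # xs)) (\<lambda>j u. if u = 0 then 0 else F (k # j # (u - 1) # xs)) m"
    have "?u \<noteq> 0" and F: "F (k # m # (?u - 1) # xs) = Suc y"
      using Suc.prems by (auto split: if_splits)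
    then have "eval (Prim g h) (m # xs) (?u - 1)" by (intro Suc.IH) simp
    moreover have "eval h (m # (?u - 1) # xs) y"
      using stagesD(2)[OF h F] ys by simp
    ultimately show ?case by (auto simp: eval_Prim_Suc_iff)
  qed
  with eq show "eval (Prim g h) ys y" by (simp add: ys cong: if_cong)
next
  fix ys y assume "length ys = Suc n" and ev: "eval (Prim g h) ys y"
  then obtain m xs where ys: "ys = m # xs" "length xs = n" by (auto simp: length_Suc_conv)
  have "eval (Prim g h) (m # xs) y \<Longrightarrow> \<forall>\<^sub>F k in sequentially.
    rec_nat (G (k # xs)) (\<lambda>j u. if u = 0 then 0 else F (k # j # (u - 1) # xs)) m = Suc y"
  proof (induction m arbitrary: y)
    case 0
    then show ?case using stagesD(3)[OF g] ys by (auto simp: eval_Prim_0_iff)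
  next
    case (Suc m)
    then obtain v where v: "eval (Prim g h) (m # xs) v" "eval h (m # v # xs) y"
      by (auto simp: eval_Prim_Suc_iff)
    have "\<forall>\<^sub>F k in sequentially. F (k # m # v # xs) = Suc y"
      using stagesD(3)[OF h v(2)] ys by simp
    with Suc.IH[OF v(1)] show ?case
      by eventually_elim simp
  qed
  with ev show "\<forall>\<^sub>F k in sequentially. ?R (k # ys) = Suc y" by (simp add: ys cong: if_cong)
qed

text \<open>Stage \<open>k\<close> searches only below \<open>k\<close>, which turns minimisation
  into a bounded sum. As outputs are stored with a \<open>Suc\<close>, the value
  \<open>Suc 0\<close> means output 0 and values from 2 on mean positive outputs.\<close>

lemma stages_Mn:
  assumes f: "stages f (Suc n) F"
  defines "good \<equiv> \<lambda>k xs y. F (k # y # xs) = Suc 0 \<and> (\<forall>z<y. 2 \<le> F (k # z # xs))"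
  shows "stages (Mn f) n (\<lambda>ys. \<Sum>y<ys ! 0. if good (ys ! 0) (drop 1 ys) y then Suc y else 0)"
    (is "stages _ _ ?R")
proof -
  have R_eq: "?R (k # xs) = Suc y" if y: "good k xs y" "y < k" for k xs y
  proof -
    \<comment> \<open>Of two different good numbers, the larger would force a value of at least 2 at
      the smaller one, where the value is 1. So the sum has one nonzero term.\<close>
    have "good k xs z \<longleftrightarrow> z = y" for z
      using y(1) unfolding good_def by (cases y z rule: linorder_cases) auto
    with y(2) show ?thesis by simp
  qed
  show ?thesis
  proof (rule stagesI)
    have "recfn (Suc (Suc (Suc n))) (\<lambda>zs. F (map (\<lambda>g. g zs) [\<lambda>zs. zs ! 2, \<lambda>zs. zs ! 0] @ drop 3 zs))"
      by (rule recfn_comp_drop) (use stagesD(1)[OF f] in \<open>auto intro!: recfn_nth\<close>)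
    then have "recfn (Suc (Suc (Suc n))) (\<lambda>zs. of_bool (2 \<le> F (zs ! 2 # zs ! 0 # drop 3 zs)))"
      by (intro recfn_le recfn_const) simp
    from recfn_Ball_less[OF this, of "\<lambda>zs. zs ! 0"]
    have 1: "recfn (Suc (Suc n)) (\<lambda>zs. of_bool (\<forall>z<zs ! 0. 2 \<le> F (zs ! 1 # z # drop 2 zs)))"
      by (simp add: recfn_nth)
    have "recfn (Suc (Suc n)) (\<lambda>zs. F (map (\<lambda>g. g zs) [\<lambda>zs. zs ! 1, \<lambda>zs. zs ! 0] @ drop 2 zs))"
      by (rule recfn_comp_drop) (use stagesD(1)[OF f] in \<open>auto intro!: recfn_nth\<close>)
    then have "recfn (Suc (Suc n)) (\<lambda>zs. if good (zs ! 1) (drop 2 zs) (zs ! 0) then Suc (zs ! 0) else 0)"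
      unfolding good_def by (intro recfn_If recfn_conj recfn_eq recfn_Suc recfn_nth recfn_const 1) auto
    from recfn_sum[OF this, of "\<lambda>ys. ys ! 0"] show "recfn (Suc n) ?R"
      by (simp add: recfn_nth cong: if_cong)
  next
    fix xs k y assume xs: "length xs = n" and eq: "?R (k # xs) = Suc y"
    have "\<exists>y'<k. good k xs y'"
    proof (rule ccontr)
      assume "\<not> (\<exists>y'<k. good k xs y')"
      then have "?R (k # xs) = 0" by simp
      with eq show False by (simp only: nat.distinct)
    qed
    then obtain y' where y': "y' < k" "good k xs y'" by blast
    with eq R_eq have "y' = y" by fastforce
    have "eval f (y # xs) 0" using y' \<open>y' = y\<close> stagesD(2)[OF f] xs by (auto simp: good_def)
    moreover have "\<exists>v. eval f (z # xs) (Suc v)" if "z < y" for z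
    proof -
      have "F (k # z # xs) = Suc (Suc (F (k # z # xs) - 2))"
        using y' \<open>y' = y\<close> that by (auto simp: good_def)
      from stagesD(2)[OF f this] xs show ?thesis by auto
    qed
    ultimately show "eval (Mn f) xs y" by (auto simp: eval_Mn_iff)
  next
    fix xs y assume xs: "length xs = n" and "eval (Mn f) xs y"
    then have y: "eval f (y # xs) 0" and z: "\<forall>z<y. \<exists>v. eval f (z # xs) (Suc v)"
      by (auto simp: eval_Mn_iff)
    have "\<forall>\<^sub>F k in sequentially. \<forall>z\<in>{..<y}. 2 \<le> F (k # z # xs)"
    proof (rule eventually_ball_finite)
      show "\<forall>z\<in>{..<y}. \<forall>\<^sub>F k in sequentially. 2 \<le> F (k # z # xs)"
      proof
        fix z' assume "z' \<in> {..<y}"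
        then obtain v where "eval f (z' # xs) (Suc v)" using z by auto
        from stagesD(3)[OF f this] xs have "\<forall>\<^sub>F k in sequentially. F (k # z' # xs) = Suc (Suc v)" by simp
        then show "\<forall>\<^sub>F k in sequentially. 2 \<le> F (k # z' # xs)" by eventually_elim simp
      qed
    qed simp
    moreover have "\<forall>\<^sub>F k in sequentially. F (k # y # xs) = Suc 0"
      using stagesD(3)[OF f y] xs by simp
    ultimately show "\<forall>\<^sub>F k in sequentially. ?R (k # xs) = Suc y"
      using eventually_gt_at_top[of y]
    proof eventually_elim
      case (elim k)
      then have gy: "good k xs y" by (auto simp: good_def)
      with elim show ?case by (intro R_eq)
    qed
  qed
qed

text \<open>Induction on \<open>r\<close> with arbitrary arity, which changes in subterms. Where no
  evaluation rule fits the arity, the constant 0 is a correct stage function.\<close>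

lemma stages_exists: "\<exists>F. stages r n F"
proof (induction r arbitrary: n)
  case Z
  have "stages Z n (\<lambda>_. 1)"
    by (rule stagesI) (auto simp: eval_Z_iff recfn_const[of _ 1, simplified])
  then show ?case by (rule exI[where P = "stages _ _"])
next
  case S
  show ?case
  proof (cases n)
    case 0
    have "stages S n (\<lambda>_. 0)"
      by (rule stagesI) (auto simp: eval_S_iff recfn_const 0)
    then show ?thesis by (rule exI[where P = "stages _ _"])
  next
    case (Suc m)
    have "stages S n (\<lambda>ys. Suc (Suc (ys ! 1)))"
      by (rule stagesI) (auto simp: eval_S_iff length_Suc_conv Suc intro!: recfn_Suc recfn_nth)
    then show ?thesis by (rule exI[where P = "stages _ _"])
  qed
next
  case (Proj i)
  show ?case
  proof (cases "i < n")
    case False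
    have "stages (Proj i) n (\<lambda>_. 0)"
      by (rule stagesI) (auto simp: eval_Proj_iff recfn_const False)
    then show ?thesis by (rule exI[where P = "stages _ _"])
  next
    case True
    have "stages (Proj i) n (\<lambda>ys. Suc (ys ! Suc i))"
      by (rule stagesI) (auto simp: eval_Proj_iff True intro!: recfn_Suc recfn_nth)
    then show ?thesis by (rule exI[where P = "stages _ _"])
  qed
next
  case (Comp f gs)
  obtain F where F: "stages f (length gs) F" using Comp(1) by blast
  have "\<forall>g\<in>set gs. \<exists>G. stages g n G" using Comp(2) by blast
  then obtain G where "\<forall>g\<in>set gs. stages g n (G g)" by (auto dest!: bchoice)
  from stages_Comp[OF F this] show ?case by (rule exI[where P = "stages _ _"])
next
  case (Prim g h)
  show ?case
  proof (cases n)
    case 0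
    have "stages (Prim g h) n (\<lambda>_. 0)"
      by (rule stagesI) (auto simp: eval_Prim_Nil_iff recfn_const 0)
    then show ?thesis by (rule exI[where P = "stages _ _"])
  next
    case (Suc m)
    obtain G F where "stages g m G" "stages h (Suc (Suc m)) F" using Prim by blast
    from stages_Prim[OF this] show ?thesis unfolding Suc by (rule exI[where P = "stages _ _"])
  qed
next
  case (Mn f)
  then obtain F where "stages f (Suc n) F" by blast
  from stages_Mn[OF this] show ?case by (rule exI[where P = "stages _ _"])
qed

section \<open>Codes of binary strings\<close>

text \<open>Strings of equal length have codes in one block between powers of 2, which makes the
  length computable from the code.\<close>

lemma str_to_nat_bounds:
  "2 ^ length s \<le> str_to_nat s + 1" "str_to_nat s + 1 < 2 ^ Suc (length s)"
  by (induction s) auto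

lemma inj_str_to_nat: "inj str_to_nat"
proof (rule injI)
  fix s t :: "bool list"
  show "str_to_nat s = str_to_nat t \<Longrightarrow> s = t"
  proof (induction s arbitrary: t)
    case Nil
    then show ?case by (cases t) (auto split: if_splits)
  next
    case (Cons b s)
    then obtain b' t' where t: "t = b' # t'" by (cases t) (auto split: if_splits)
    have "b = b' \<and> str_to_nat s = str_to_nat t'"
      using Cons.prems unfolding t by (auto split: if_splits; presburger)
    with Cons.IH t show ?case by blast
  qed
qed

lemma surj_str_to_nat: "surj str_to_nat"
proof -
  have "\<exists>s. str_to_nat s = n" for n
  proof (induction n rule: less_induct)
    case (less n)
    show ?case
    proof (cases "n = 0")
      case True
      then show ?thesis by (intro exI[of _ "[]"]) simp
    next
      case False
      \<comment> \<open>For both parities \<open>(n - 1) div 2\<close> is the code of the tail, and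
        the parity of \<open>n\<close> gives the first bit.\<close>
      then have "(n - 1) div 2 < n" by auto
      then obtain s where "str_to_nat s = (n - 1) div 2" using less by blast
      then have "str_to_nat (even n # s) = n"
        using False by (cases "even n") (auto elim!: evenE oddE)
      then show ?thesis ..
    qed
  qed
  then show ?thesis by (auto simp: surj_def eq_commute[of _ "str_to_nat _"])
qed

text \<open>The integer part of the binary logarithm of \<open>n + 1\<close>, as a bounded count to
  which \<open>recfn_sum\<close> applies.\<close>

definition code_len :: "nat \<Rightarrow> nat" where
  "code_len n = (\<Sum>l<n. of_bool (2 ^ Suc l \<le> n + 1))"

lemma code_len_str_to_nat [simp]: "code_len (str_to_nat s) = length s"
proof -
  let ?n = "str_to_nat s"
  have "2 ^ Suc l \<le> ?n + 1 \<longleftrightarrow> l < length s" for l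
  proof
    assume "2 ^ Suc l \<le> ?n + 1"
    then have "(2::nat) ^ Suc l < 2 ^ Suc (length s)" using str_to_nat_bounds(2)[of s] by linarith
    then show "l < length s" by simp
  next
    assume "l < length s"
    then have "(2::nat) ^ Suc l \<le> 2 ^ length s" by (intro power_increasing) auto
    then show "2 ^ Suc l \<le> ?n + 1" using str_to_nat_bounds(1)[of s] by linarith
  qed
  moreover have "length s \<le> ?n"
    using str_to_nat_bounds(1)[of s] less_exp[of "length s"] by linarith
  then have "{..<?n} \<inter> {l. l < length s} = {..<length s}" by auto
  ultimately show ?thesis
    by (simp add: code_len_def sum.If_cases of_bool_def)
qed

lemma recfn_code_len:
  assumes "recfn n A"
  shows "recfn n (\<lambda>xs. code_len (A xs))"
proof (rule recfn_comp1[OF _ assms])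
  have "recfn (Suc 1) (\<lambda>ys. of_bool (2 ^ Suc (ys ! 0) \<le> ys ! 1 + 1))"
    by (intro recfn_intros recfn_Suc) auto
  from recfn_sum[OF this, of "\<lambda>xs. xs ! 0"] show "recfn 1 (\<lambda>xs. code_len (xs ! 0))"
    by (simp add: code_len_def recfn_nth[of 0 "Suc 0", simplified])
qed

section \<open>Compressible strings\<close>

text \<open>A codeword of length \<open>l\<close> has \<open>2 ^ (M - l)\<close> extensions to a
  common length \<open>M\<close>. Prefix-freeness makes these sets disjoint, and there are only
  \<open>2 ^ M\<close> strings of length \<open>M\<close>.\<close>

lemma Kraft_inequality:
  assumes "finite A" "prefix_free A"
  shows "(\<Sum>p\<in>A. (1/2) ^ length p) \<le> (1::real)"
proof -
  define M where "M = Max (insert 0 (length ` A))"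
  have M: "length p \<le> M" if "p \<in> A" for p
    using that assms(1) by (auto simp: M_def)
  define E where "E = (\<lambda>p. {q :: bool list. length q = M \<and> prefix p q})"
  have card_lists: "card {r :: bool list. length r = k} = 2 ^ k" for k
    using card_lists_length_eq[of "UNIV :: bool set" k] by simp
  have fin: "finite {r :: bool list. length r = k}" for k
    using finite_lists_length_eq[of "UNIV :: bool set" k] by simp
  have card_E: "card (E p) = 2 ^ (M - length p)" if "p \<in> A" for p
  proof -
    have "E p = (\<lambda>r. p @ r) ` {r. length r = M - length p}"
      using M[OF that] by (auto simp: E_def prefix_def)
    then show ?thesis by (simp add: card_image card_lists inj_on_def)
  qed
  have "card (\<Union>p\<in>A. E p) = (\<Sum>p\<in>A. card (E p))"
  proof (rule card_UN_disjoint)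
    show "\<forall>p\<in>A. finite (E p)" by (auto simp: E_def intro: finite_subset[OF _ fin[of M]])
    show "\<forall>p\<in>A. \<forall>q\<in>A. p \<noteq> q \<longrightarrow> E p \<inter> E q = {}"
      using assms(2) prefix_same_cases unfolding E_def prefix_free_def by blast
  qed (rule assms)
  also have "\<dots> = (\<Sum>p\<in>A. 2 ^ (M - length p))"
    by (intro sum.cong card_E refl)
  finally have "(\<Sum>p\<in>A. 2 ^ (M - length p)) \<le> card {r :: bool list. length r = M}"
    using card_mono[OF fin[of M], of "\<Union>p\<in>A. E p"] by (auto simp: E_def)
  then have "(\<Sum>p\<in>A. 2 ^ (M - length p)) \<le> (2::nat) ^ M"
    by (simp add: card_lists)
  then have "real (\<Sum>p\<in>A. 2 ^ (M - length p)) \<le> real (2 ^ M)"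
    by (rule of_nat_mono)
  then have "(\<Sum>p\<in>A. 2 ^ (M - length p)) \<le> (2::real) ^ M"
    by simp
  also have "(\<Sum>p\<in>A. 2 ^ (M - length p)) = (\<Sum>p\<in>A. 2 ^ M * (1/2::real) ^ length p)"
    by (intro sum.cong refl) (simp add: M power_diff power_one_over)
  also have "\<dots> = 2 ^ M * (\<Sum>p\<in>A. (1/2) ^ length p)"
    by (simp add: sum_distrib_left)
  finally show ?thesis by simp
qed

definition compressible :: "(bool list \<Rightarrow> bool list option) \<Rightarrow> bool list set" where
  "compressible V = {s. H V s < enat (length s)}"

lemma compressible_iff: "s \<in> compressible V \<longleftrightarrow> (\<exists>p. V p = Some s \<and> length p < length s)"
  by (auto simp: compressible_def H_def INF_less_iff)

section \<open>Weights and the convergence of \<open>Theta\<close>\<close>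

definition weight :: "real \<Rightarrow> bool list \<Rightarrow> real" where
  "weight t s = 2 powr (- real (length s) / t)"

lemma weight_pos: "0 < weight t s"
  by (simp add: weight_def)

lemma weight_le_1: "0 < t \<Longrightarrow> weight t s \<le> 1"
  using powr_mono[of "- real (length s) / t" 0 2] by (simp add: weight_def)

lemma weight_mono: "0 < t \<Longrightarrow> t \<le> t' \<Longrightarrow> weight t s \<le> weight t' s"
  by (auto simp: weight_def intro!: powr_mono divide_left_mono)

lemma weight_strict_mono: "0 < t \<Longrightarrow> t < t' \<Longrightarrow> s \<noteq> [] \<Longrightarrow> weight t s < weight t' s"
  by (auto simp: weight_def intro!: powr_less_mono divide_strict_left_mono)

lemma Theta_eq: "Theta V t = infsum (weight t) (compressible V)"
  by (simp add: Theta_def compressible_def weight_def[abs_def])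

text \<open>Choose for each compressible string a program shorter than it. The choice is injective,
  as \<open>V\<close> inverts it, and a weight at \<open>t \<le> 1\<close> is at most the Kraft term
  of the program, so all finite sums are at most 1.\<close>

lemma weight_summable:
  assumes "prefix_free (dom V)" "0 < t" "t \<le> 1"
  shows "weight t summable_on compressible V"
proof (rule nonneg_bdd_above_summable_on)
  show "bdd_above (sum (weight t) ` {F. F \<subseteq> compressible V \<and> finite F})"
  proof (rule bdd_aboveI2)
    fix F assume F: "F \<in> {F. F \<subseteq> compressible V \<and> finite F}"
    then have "\<forall>s\<in>F. \<exists>p. V p = Some s \<and> length p < length s"
      using compressible_iff by blast
    then obtain P where P: "\<forall>s\<in>F. V (P s) = Some s \<and> length (P s) < length s"
      by (auto dest!: bchoice)
    have inj: "inj_on P F"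
      by (rule inj_on_inverseI[where g = "\<lambda>p. the (V p)"]) (use P in simp)
    have "P ` F \<subseteq> dom V" using P by auto
    then have "prefix_free (P ` F)"
      using assms(1) unfolding prefix_free_def by blast
    then have K: "(\<Sum>p\<in>P ` F. (1/2) ^ length p) \<le> (1::real)"
      using F by (intro Kraft_inequality) auto
    have "weight t s \<le> (1/2) ^ length (P s)" if "s \<in> F" for s
    proof -
      have "weight t s \<le> weight 1 s" using assms by (intro weight_mono) auto
      also have "\<dots> = (1/2) ^ length s"
        by (simp add: weight_def powr_minus powr_realpow power_one_over inverse_eq_divide)
      also have "\<dots> \<le> (1/2) ^ length (P s)"
        using P that by (intro power_decreasing) auto
      finally show ?thesis .
    qed
    then have "sum (weight t) F \<le> (\<Sum>s\<in>F. (1/2) ^ length (P s))"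
      by (rule sum_mono)
    also have "\<dots> = (\<Sum>p\<in>P ` F. (1/2) ^ length p)"
      by (simp add: sum.reindex[OF inj])
    finally show "sum (weight t) F \<le> 1" using K by simp
  qed
qed (simp add: weight_pos less_imp_le)

text \<open>Raising the temperature and adding terms both increase the sum. This is why grid points
  up to \<open>T\<close> always pass the later test.\<close>

lemma sum_weight_le_Theta:
  assumes "prefix_free (dom V)" "0 < t" "t \<le> T" "T \<le> 1" "finite F" "F \<subseteq> compressible V"
  shows "sum (weight t) F \<le> Theta V T"
proof -
  have "sum (weight t) F \<le> sum (weight T) F"
    using assms by (intro sum_mono weight_mono) auto
  also have "\<dots> \<le> infsum (weight T) (compressible V)"
    using assms by (intro finite_sum_le_infsum weight_summable) (auto simp: weight_pos less_imp_le)
  finally show ?thesis by (simp add: Theta_eq)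
qed

text \<open>A partial sum at \<open>T\<close> is taken that misses \<open>Theta V T\<close> by less
  than the gain of the single string \<open>s\<close> between \<open>T\<close> and \<open>t\<close>.
  The sum is finite because \<open>t\<close> may exceed 1, outside the range of
  \<open>weight_summable\<close>.\<close>

lemma Theta_less_sum_weight:
  assumes "prefix_free (dom V)" "0 < T" "T < t" "T \<le> 1" "s \<in> compressible V"
  obtains F where "finite F" "F \<subseteq> compressible V" "Theta V T < sum (weight t) F"
proof -
  \<comment> \<open>The empty string has weight 1 at every temperature and would give no
    gain.\<close>
  have "s \<noteq> []" using assms by (auto simp: compressible_iff)
  then have gap: "weight T s < weight t s" using assms by (intro weight_strict_mono) auto
  have "(weight T has_sum Theta V T) (compressible V)"
    unfolding Theta_eq using assms by (intro has_sum_infsum weight_summable) auto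
  then have "\<forall>\<^sub>F F in finite_subsets_at_top (compressible V).
      Theta V T - (weight t s - weight T s) < sum (weight T) F"
    unfolding has_sum_def using gap by (intro order_tendstoD(1)) auto
  then obtain F0 where F0: "finite F0" "F0 \<subseteq> compressible V"
    and big: "\<forall>F. finite F \<and> F0 \<subseteq> F \<and> F \<subseteq> compressible V \<longrightarrow>
      Theta V T - (weight t s - weight T s) < sum (weight T) F"
    unfolding eventually_finite_subsets_at_top by (elim exE conjE)
  let ?F = "insert s F0"
  have "Theta V T < sum (weight T) ?F + (weight t s - weight T s)"
    using big[rule_format, of ?F] F0 assms by (simp add: subset_insertI)
  also have "\<dots> = sum (weight T) (F0 - {s}) + weight t s"
    using F0 by (simp add: sum.insert_remove)
  also have "\<dots> \<le> sum (weight t) (F0 - {s}) + weight t s"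
    using assms by (intro add_right_mono sum_mono weight_mono) auto
  also have "\<dots> = sum (weight t) ?F"
    using F0 by (simp add: sum.insert_remove)
  finally show ?thesis using that[of ?F] F0 assms by auto
qed

section \<open>Existence of a compressible string\<close>

lemma str_to_nat_replicate: "str_to_nat (replicate n False @ [True]) + 1 = 3 * 2 ^ n"
  by (induction n) auto

text \<open>Optimality is applied to the machine that maps \<open>0\<^sup>n1\<close>, whose code is \<open>x = 3 \<cdot> 2\<^sup>n - 1\<close>, to the
  string of code \<open>x\<^sup>2\<close>, which is about twice as long.\<close>

lemma optimal_compressible_nonempty:
  assumes "optimal V"
  shows "compressible V \<noteq> {}"
proof -
  \<comment> \<open>The bound \<open>n < x + 1\<close> makes the test decidable and excludes
    nothing, as \<open>n < 3 * 2 ^ n\<close>.\<close>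
  define inD where "inD = (\<lambda>x. \<exists>n<x + 1. x + 1 = 3 * 2 ^ n)"
  define C where "C = (\<lambda>p. if inD (str_to_nat p)
    then Some (inv str_to_nat (str_to_nat p * str_to_nat p)) else None)"
  have str_inv: "str_to_nat (inv str_to_nat n) = n" for n
    by (rule surj_f_inv_f[OF surj_str_to_nat])
  have inD: "inD (str_to_nat p) \<longleftrightarrow> (\<exists>n. p = replicate n False @ [True])" for p
  proof
    assume "inD (str_to_nat p)"
    then obtain n where "str_to_nat p + 1 = 3 * 2 ^ n" by (auto simp: inD_def)
    then have "str_to_nat p = str_to_nat (replicate n False @ [True])"
      using str_to_nat_replicate[of n] by simp
    then show "\<exists>n. p = replicate n False @ [True]"
      using inj_str_to_nat by (auto dest: injD)
  next
    assume "\<exists>n. p = replicate n False @ [True]"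
    then obtain n where p: "p = replicate n False @ [True]" ..
    have "n < 3 * 2 ^ n" using less_exp[of n] by linarith
    then show "inD (str_to_nat p)"
      using str_to_nat_replicate[of n] unfolding inD_def p by auto
  qed
  have "prefix_free (dom C)"
    unfolding prefix_free_def
  proof safe
    fix p q y y' assume "C p = Some y" "C q = Some y'" and pre: "prefix p q"
    then obtain n m where p: "p = replicate n False @ [True]" and q: "q = replicate m False @ [True]"
      using inD by (auto simp: C_def split: if_splits)
    have "n \<le> m" using prefix_length_le[OF pre] by (simp add: p q)
    moreover have "q ! n = True"
      using pre by (auto simp: p prefix_def nth_append)
    ultimately have "n = m" by (cases "n = m") (auto simp: q nth_append)
    then show "p = q" by (simp add: p q)
  qed
  moreover have "partial_recursive_str C"
  proof -
    have "recfn (Suc (Suc (Suc 0))) (\<lambda>zs. of_bool (\<not> zs ! 2 + 1 = 3 * 2 ^ (zs ! 0)))"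
      by (intro recfn_intros) auto
    from recfn_not[OF recfn_Ball_less[OF this, of "\<lambda>zs. zs ! 1 + 1"]]
    have "recfn 2 (\<lambda>zs. of_bool (inD (zs ! 1)))"
      by (simp add: inD_def numeral_2_eq_2 recfn_Suc recfn_nth)
    then have "recfn 2 (\<lambda>zs. of_bool (\<not> (inD (zs ! 1) \<and> zs ! 0 = zs ! 1 * zs ! 1)))"
      by (intro recfn_intros) auto
    then obtain r where r: "\<And>zs y. length zs = 2 \<Longrightarrow>
        eval r zs y \<longleftrightarrow> y = of_bool (\<not> (inD (zs ! 1) \<and> zs ! 0 = zs ! 1 * zs ! 1))"
      unfolding recfn_def by blast
    \<comment> \<open>The search stops at the square of \<open>x\<close>. If \<open>inD x\<close>
      fails, \<open>r\<close> is constantly 1 and the search diverges.\<close>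
    have "eval (Mn r) [x] y \<longleftrightarrow> inD x \<and> y = x * x" for x y
      by (auto simp: eval_Mn_iff r)
    then show ?thesis unfolding partial_recursive_str_def
      by (intro exI[of _ "Mn r"]) (auto simp: C_def str_inv)
  qed
  ultimately have "prefix_free_machine C" by (simp add: prefix_free_machine_def)
  then obtain d where d: "\<And>p. p \<in> dom C \<Longrightarrow> \<exists>q\<in>dom V. V q = C p \<and> length q \<le> length p + d"
    using assms unfolding optimal_def by blast
  \<comment> \<open>Taking \<open>d\<close> as the number of \<open>False\<close> bits gives
    \<open>s\<close> a program of length at most \<open>2 * d + 1\<close>, while its code is at
    least \<open>2 ^ (2 * d + 2)\<close>, so its length is at least
    \<open>2 * d + 2\<close>.\<close>
  define p where "p = replicate d False @ [True]"
  define x where "x = str_to_nat p"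
  define s where "s = inv str_to_nat (x * x)"
  have C: "C p = Some s" using inD[of p] by (auto simp: C_def p_def s_def x_def)
  then obtain q where q: "V q = Some s" "length q \<le> length p + d" using d[of p] by auto
  have "x + 1 = 3 * 2 ^ d" unfolding x_def p_def by (rule str_to_nat_replicate)
  then have "2 ^ (d + 1) \<le> x" using one_le_power[of "2::nat" d] by simp
  then have "2 ^ (d + 1) * 2 ^ (d + 1) \<le> x * x" by (intro mult_mono) auto
  then have "(2::nat) ^ (2 * d + 2) \<le> x * x"
    by (simp only: power_add[symmetric]) (simp add: mult_2)
  also have "x * x = str_to_nat s" by (simp add: s_def str_inv)
  also have "\<dots> < 2 ^ Suc (length s)" using str_to_nat_bounds(2)[of s] by linarith
  finally have "2 * d + 2 < Suc (length s)" by (rule power_less_imp_less_exp[rotated]) simp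
  with q have "s \<in> compressible V" by (auto simp: compressible_iff p_def)
  then show ?thesis by blast
qed

section \<open>Approximation of the temperature\<close>

text \<open>Here \<open>p\<close> and \<open>s\<close> are codes. Since \<open>m\<close> is both the
  stage and the bound on programs, each program is tried from some \<open>m\<close> on.\<close>

definition found :: "(nat list \<Rightarrow> nat) \<Rightarrow> nat \<Rightarrow> nat \<Rightarrow> bool" where
  "found F m s \<longleftrightarrow> (\<exists>p<m. F [m, p] = Suc s \<and> code_len p < code_len s)"

text \<open>With \<open>t = i / (m + 1)\<close> this is \<open>\<lfloor>(m + 1) \<cdot> 2\<^sup>-\<^sup>L\<^sup>/\<^sup>t\<rfloor>\<close>, written without roots.\<close>

definition floor_weight :: "nat \<Rightarrow> nat \<Rightarrow> nat \<Rightarrow> nat" where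
  "floor_weight m i L = (\<Sum>w<m + 1. of_bool ((w + 1) ^ i * 2 ^ (L * (m + 1)) \<le> (m + 1) ^ i))"

definition lower_sum :: "(nat list \<Rightarrow> nat) \<Rightarrow> nat \<Rightarrow> nat \<Rightarrow> nat" where
  "lower_sum F m i = (\<Sum>s<m. of_bool (found F m s) * floor_weight m i (code_len s))"

lemma recfn_lower_sum:
  assumes F: "recfn 2 F"
  shows "recfn 2 (\<lambda>xs. lower_sum F (xs ! 1) (xs ! 0))"
proof -
  \<comment> \<open>The list is \<open>p # s # i # m\<close>; the quantifier over \<open>p\<close>
    and the sum over \<open>s\<close> each remove the head.\<close>
  have "recfn 4 (\<lambda>xs. F (map (\<lambda>g. g xs) [\<lambda>xs. xs ! 3, \<lambda>xs. xs ! 0]))"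
    by (rule recfn_comp) (use F in \<open>auto simp: numeral_2_eq_2 intro!: recfn_nth\<close>)
  then have "recfn (Suc 3) (\<lambda>xs. of_bool (\<not> (F [xs ! 3, xs ! 0] = Suc (xs ! 1)
      \<and> code_len (xs ! 0) < code_len (xs ! 1))))"
    by (intro recfn_intros recfn_Suc recfn_code_len) auto
  from recfn_not[OF recfn_Ball_less[OF this, of "\<lambda>xs. xs ! 2"]]
  have found: "recfn 3 (\<lambda>xs. of_bool (found F (xs ! 2) (xs ! 0)))"
    by (simp add: found_def recfn_nth)
  have "recfn (Suc 3) (\<lambda>xs. of_bool ((xs ! 0 + 1) ^ (xs ! 2) *
      2 ^ (code_len (xs ! 1) * (xs ! 3 + 1)) \<le> (xs ! 3 + 1) ^ (xs ! 2)))"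
    by (intro recfn_intros recfn_code_len) auto
  from recfn_sum[OF this, of "\<lambda>xs. xs ! 2 + 1"]
  have "recfn 3 (\<lambda>xs. floor_weight (xs ! 2) (xs ! 1) (code_len (xs ! 0)))"
    by (simp add: floor_weight_def recfn_nth recfn_Suc del: sum.lessThan_Suc)
  then have "recfn (Suc 2) (\<lambda>xs. of_bool (found F (xs ! 2) (xs ! 0)) *
      floor_weight (xs ! 2) (xs ! 1) (code_len (xs ! 0)))"
    using found by (intro recfn_mult) simp_all
  from recfn_sum[OF this, of "\<lambda>xs. xs ! 1"] show ?thesis
    by (simp add: lower_sum_def recfn_nth)
qed

text \<open>For \<open>t = i / (m + 1)\<close>, the \<open>i\<close>-th power of the weight times
  \<open>2 ^ (length s * (m + 1))\<close> is 1. Raising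
  \<open>w + 1 \<le> (m + 1) * weight t s\<close> to the power \<open>i\<close> therefore gives the
  integer test, and the floor counts the \<open>w\<close> that pass.\<close>

lemma floor_weight_eq:
  assumes "0 < i"
  shows "floor_weight m i (length s) = nat \<lfloor>real (m + 1) * weight (real i / real (m + 1)) s\<rfloor>"
proof -
  define t where "t = real i / real (m + 1)"
  define y where "y = real (m + 1) * weight t s"
  have t: "0 < t" using assms by (simp add: t_def)
  have y: "0 \<le> y" "y \<le> real (m + 1)"
    using weight_pos[of t s] weight_le_1[OF t, of s] mult_left_mono[of "weight t s" 1 "real (m + 1)"]
    by (auto simp: y_def)
  have wi: "weight t s ^ i * 2 ^ (length s * (m + 1)) = 1"
  proof -
    have "weight t s ^ i = 2 powr (- real (length s) / t * real i)"
      by (simp add: weight_def powr_realpow[symmetric] powr_powr)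
    also have "- real (length s) / t * real i = - real (length s * (m + 1))"
      using assms by (simp add: t_def field_simps)
    finally have "weight t s ^ i = 2 powr (- real (length s * (m + 1)))" .
    moreover have "2 powr real (length s * (m + 1)) = 2 ^ (length s * (m + 1))"
      by (rule powr_realpow) simp
    ultimately show ?thesis by (simp only: powr_minus) simp
  qed
  have "(w + 1) ^ i * 2 ^ (length s * (m + 1)) \<le> (m + 1) ^ i \<longleftrightarrow> w < nat \<lfloor>y\<rfloor>" for w
  proof -
    have "(w + 1) ^ i * 2 ^ (length s * (m + 1)) \<le> (m + 1) ^ i \<longleftrightarrow>
        real ((w + 1) ^ i * 2 ^ (length s * (m + 1))) \<le> real ((m + 1) ^ i)"
      by (simp only: of_nat_le_iff)
    also have "\<dots> \<longleftrightarrow> real (w + 1) ^ i * 2 ^ (length s * (m + 1)) \<le>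
        real (m + 1) ^ i * (weight t s ^ i * 2 ^ (length s * (m + 1)))"
      by (simp only: wi of_nat_mult of_nat_power of_nat_numeral mult_1_right)
    also have "\<dots> \<longleftrightarrow> real (w + 1) ^ i \<le> y ^ i"
      unfolding y_def power_mult_distrib mult.assoc[symmetric]
      by (rule mult_le_cancel_right_pos) simp
    also have "\<dots> \<longleftrightarrow> real (w + 1) \<le> y"
      using assms y by (intro power_mono_iff) auto
    also have "\<dots> \<longleftrightarrow> w < nat \<lfloor>y\<rfloor>" by linarith
    finally show ?thesis .
  qed
  \<comment> \<open>The range of \<open>w\<close> is long enough because a weight is at most
    1.\<close>
  moreover have "{..<m + 1} \<inter> {w. w < nat \<lfloor>y\<rfloor>} = {..<nat \<lfloor>y\<rfloor>}"
    using y by (auto; linarith)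
  ultimately show ?thesis
    by (simp add: floor_weight_def sum.If_cases of_bool_def t_def y_def del: sum.lessThan_Suc)
qed

text \<open>The grid point \<open>i = 0\<close> is treated apart, since division by 0 would make
  \<open>weight\<close> equal to 1 there. In the integer test both \<open>i\<close>-th powers are
  1.\<close>

lemma floor_weight_0:
  assumes "0 < L"
  shows "floor_weight m 0 L = 0"
proof -
  have "1 < (2::nat) ^ (L * (m + 1))" using assms by (intro one_less_power) auto
  then show ?thesis by (simp add: floor_weight_def del: sum.lessThan_Suc)
qed

text \<open>Soundness of the search: an output seen at any stage is a true value of
  \<open>V\<close>.\<close>

lemma found_imp_compressible:
  assumes r: "\<And>p y. eval r [str_to_nat p] y \<longleftrightarrow> (\<exists>s. V p = Some s \<and> y = str_to_nat s)"
    and F: "stages r 1 F"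
    and "found F m (str_to_nat s)"
  shows "s \<in> compressible V"
proof -
  obtain n where n: "F [m, n] = Suc (str_to_nat s)" "code_len n < length s"
    using assms(3) by (auto simp: found_def)
  obtain p where p: "n = str_to_nat p" using surj_str_to_nat by (auto simp: surj_def)
  have "eval r [str_to_nat p] (str_to_nat s)"
    using stagesD(2)[OF F n(1)] by (simp add: p)
  then have "V p = Some s" by (auto simp: r dest: injD[OF inj_str_to_nat])
  with n show ?thesis by (auto simp: p compressible_iff)
qed

text \<open>Completeness of the search: one short program suffices, once \<open>m\<close> exceeds
  its code and its stages have settled.\<close>

lemma compressible_imp_eventually_found:
  assumes r: "\<And>p y. eval r [str_to_nat p] y \<longleftrightarrow> (\<exists>s. V p = Some s \<and> y = str_to_nat s)"
    and F: "stages r 1 F"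
    and "s \<in> compressible V"
  shows "\<forall>\<^sub>F m in sequentially. found F m (str_to_nat s)"
proof -
  obtain p where p: "V p = Some s" "length p < length s"
    using assms(3) by (auto simp: compressible_iff)
  then have "eval r [str_to_nat p] (str_to_nat s)" by (simp add: r)
  then have "\<forall>\<^sub>F m in sequentially. F [m, str_to_nat p] = Suc (str_to_nat s)"
    using stagesD(3)[OF F] by simp
  then show ?thesis using eventually_gt_at_top[of "str_to_nat p"]
    by eventually_elim (use p in \<open>auto simp: found_def\<close>)
qed

lemma lower_sum_eq:
  "lower_sum F m i = (\<Sum>s | str_to_nat s < m \<and> found F m (str_to_nat s). floor_weight m i (length s))"
proof -
  let ?A = "{s. str_to_nat s < m \<and> found F m (str_to_nat s)}"
  have im: "{..<m} \<inter> {n. found F m n} = str_to_nat ` ?A"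
    using surj_str_to_nat by (auto simp: surj_def image_iff)
  have "lower_sum F m i = (\<Sum>n\<in>{..<m} \<inter> {n. found F m n}. floor_weight m i (code_len n))"
    by (auto simp: lower_sum_def sum.inter_restrict intro!: sum.cong)
  also have "\<dots> = (\<Sum>s\<in>?A. floor_weight m i (length s))"
    unfolding im by (subst sum.reindex) (auto intro: inj_on_subset[OF inj_str_to_nat])
  finally show ?thesis .
qed

lemma finite_codes_less: "finite {s. str_to_nat s < m \<and> P s}"
  by (rule finite_subset[OF _ finite_vimageI[OF finite_lessThan[of m] inj_str_to_nat]]) auto

lemma const_over_Suc_tendsto_0: "(\<lambda>n. x / (real n + 1)) \<longlonglongrightarrow> 0"
  using LIMSEQ_Suc[OF lim_const_over_n[of x]] by (simp add: add.commute)

theorem theorem11: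
  fixes V :: "bool list \<Rightarrow> bool list option" and T :: real
  assumes "optimal V"
    and "0 < T" and "T < 1"
    and "right_computable (Theta V T)"
  shows "right_computable T"
proof -
  have pf: "prefix_free (dom V)" and "partial_recursive_str V"
    using assms(1) by (auto simp: optimal_def prefix_free_machine_def)
  then obtain r where r: "\<And>p y. eval r [str_to_nat p] y \<longleftrightarrow> (\<exists>s. V p = Some s \<and> y = str_to_nat s)"
    unfolding partial_recursive_str_def by blast
  obtain F where F: "stages r 1 F" using stages_exists by blast
  obtain s0 where s0: "s0 \<in> compressible V"
    using optimal_compressible_nonempty[OF assms(1)] by blast
  obtain a b c where rec: "total_recursive a" "total_recursive b" "total_recursive c"
    and ge: "\<And>n. 1 \<le> n \<Longrightarrow> Theta V T \<le> (real (a n) - real (b n)) / (real (c n) + 1)"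
    and lim: "(\<lambda>n. (real (a n) - real (b n)) / (real (c n) + 1)) \<longlonglongrightarrow> Theta V T"
    using assms(4) unfolding right_computable_def Let_def by blast
  define f where "f = (\<lambda>n. (real (a n) - real (b n)) / (real (c n) + 1))"
  \<comment> \<open>Denominators are cleared and \<open>b m\<close> is moved to the left, since
    subtraction of naturals truncates.\<close>
  define below where "below = (\<lambda>i m. lower_sum F m i * (c m + 1) + b m * (m + 1) \<le> a m * (m + 1))"
  define cnt where "cnt = (\<lambda>m. \<Sum>i<m + 1. of_bool (below i m) :: nat)"
  have cnt_card: "cnt m = card {i. i < m + 1 \<and> below i m}" for m
    by (simp add: cnt_def of_bool_def sum.If_cases lessThan_def Collect_conj_eq del: sum.lessThan_Suc)
  have below_iff: "below i m \<longleftrightarrow> real (lower_sum F m i) / real (m + 1) \<le> f m" for i m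
  proof -
    have "below i m \<longleftrightarrow> real (lower_sum F m i * (c m + 1) + b m * (m + 1)) \<le> real (a m * (m + 1))"
      unfolding below_def by (simp only: of_nat_le_iff)
    also have "\<dots> \<longleftrightarrow> real (lower_sum F m i) / real (m + 1) \<le> f m"
      by (simp add: f_def divide_simps algebra_simps)
    finally show ?thesis .
  qed
  have total: "total_recursive cnt"
  proof -
    have abc: "recfn 2 (\<lambda>xs. a (xs ! 1))" "recfn 2 (\<lambda>xs. b (xs ! 1))" "recfn 2 (\<lambda>xs. c (xs ! 1))"
      by (rule recfn_comp1[OF rec(1)[unfolded total_recursive_iff_recfn] recfn_nth]
          recfn_comp1[OF rec(2)[unfolded total_recursive_iff_recfn] recfn_nth]
          recfn_comp1[OF rec(3)[unfolded total_recursive_iff_recfn] recfn_nth]; simp)+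
    have "recfn 2 F" using stagesD(1)[OF F] by (simp add: numeral_2_eq_2)
    then have "recfn 2 (\<lambda>xs. of_bool (below (xs ! 0) (xs ! 1)))"
      unfolding below_def
      by (intro recfn_le recfn_add recfn_mult recfn_lower_sum abc recfn_const recfn_nth) auto
    then have "recfn (Suc 1) (\<lambda>xs. of_bool (below (xs ! 0) (xs ! 1)))"
      by (simp add: numeral_2_eq_2)
    from recfn_sum[OF this, of "\<lambda>xs. xs ! 0 + 1"] show ?thesis
      unfolding total_recursive_iff_recfn
      by (simp add: cnt_def recfn_Suc recfn_nth del: sum.lessThan_Suc)
  qed
  let ?A = "\<lambda>m. {s. str_to_nat s < m \<and> found F m (str_to_nat s)}"
  have A_sub: "?A m \<subseteq> compressible V" for m
    using found_imp_compressible[OF r F] by blast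
  \<comment> \<open>Every grid point up to \<open>T\<close> is accepted for each
    \<open>m \<ge> 1\<close>: rounding down and an incomplete search only decrease the lower
    sum.\<close>
  have lower: "T * (real m + 1) < real (cnt m)" if m: "1 \<le> m" for m
  proof -
    have "below i m" if i: "real i \<le> T * (real m + 1)" for i
    proof (cases "i = 0")
      case True
      have "lower_sum F m i = 0"
        unfolding lower_sum_eq True
        using A_sub[of m] by (intro sum.neutral ballI floor_weight_0) (auto simp: compressible_iff)
      moreover have "0 \<le> Theta V T"
        unfolding Theta_eq by (intro infsum_nonneg) (simp add: weight_pos less_imp_le)
      ultimately show ?thesis using ge[OF m] by (simp add: below_iff f_def)
    next
      case False
      define t where "t = real i / real (m + 1)"
      have t: "0 < t" "t \<le> T" using False i by (auto simp: t_def divide_simps add.commute)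
      have "real (lower_sum F m i) \<le> (\<Sum>s\<in>?A m. real (m + 1) * weight t s)"
        unfolding lower_sum_eq of_nat_sum
        using False weight_pos[of t]
        by (intro sum_mono) (simp add: floor_weight_eq t_def less_imp_le del: of_nat_add of_nat_Suc)
      also have "\<dots> = real (m + 1) * sum (weight t) (?A m)"
        by (simp add: sum_distrib_left)
      also have "\<dots> \<le> real (m + 1) * Theta V T"
        using pf t assms A_sub by (intro mult_left_mono sum_weight_le_Theta finite_codes_less) auto
      also have "\<dots> \<le> real (m + 1) * f m"
        using ge[OF m] by (intro mult_left_mono) (auto simp: f_def)
      finally show ?thesis by (simp add: below_iff divide_simps mult.commute add.commute)
    qed
    moreover have "T * (real m + 1) < real m + 1" using assms by simp
    \<comment> \<open>Including \<open>i = 0\<close>, these are one more than the floor, whence the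
      strict inequality. They lie below \<open>m + 1\<close> because \<open>T < 1\<close>.\<close>
    ultimately have "{..nat \<lfloor>T * (real m + 1)\<rfloor>} \<subseteq> {i. i < m + 1 \<and> below i m}"
      using assms(2) by (auto simp: le_nat_iff le_floor_iff; linarith)
    then have "card {..nat \<lfloor>T * (real m + 1)\<rfloor>} \<le> cnt m"
      unfolding cnt_card by (intro card_mono) auto
    then show ?thesis by simp linarith
  qed
  \<comment> \<open>For large \<open>m\<close> no grid point from \<open>t\<close> on is accepted,
    as the strings of \<open>X\<close> alone already exceed \<open>f m\<close>.\<close>
  have upper: "\<forall>\<^sub>F m in sequentially. real (cnt m) \<le> t * (real m + 1) + 1" if t: "T < t" for t
  proof -
    obtain X where X: "finite X" "X \<subseteq> compressible V" "Theta V T < sum (weight t) X"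
      using Theta_less_sum_weight[OF pf assms(2) t _ s0] assms(3) by auto
    have "\<forall>\<^sub>F m in sequentially. \<forall>s\<in>X. str_to_nat s < m \<and> found F m (str_to_nat s)"
      using X by (intro eventually_ball_finite ballI eventually_conj eventually_gt_at_top
          compressible_imp_eventually_found[OF r F]) auto
    \<comment> \<open>Rounding loses at most 1 per string of \<open>X\<close>, hence
      \<open>card X / (m + 1)\<close> after scaling, which vanishes in the limit.\<close>
    moreover have "(\<lambda>m. f m + real (card X) / (real m + 1)) \<longlonglongrightarrow> Theta V T + 0"
      unfolding f_def by (intro tendsto_add lim const_over_Suc_tendsto_0)
    then have "\<forall>\<^sub>F m in sequentially. f m + real (card X) / (real m + 1) < sum (weight t) X"
      using X by (intro order_tendstoD(2)) auto
    ultimately show ?thesis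
    proof eventually_elim
      case (elim m)
      have less: "real i < t * (real m + 1)" if "below i m" for i
      proof (rule ccontr)
        assume "\<not> real i < t * (real m + 1)"
        then have ti: "t \<le> real i / real (m + 1)" by (simp add: divide_simps mult.commute add.commute)
        then have i: "0 < i" using assms t by (cases i) auto
        have "real (m + 1) * sum (weight t) X - real (card X) = (\<Sum>s\<in>X. real (m + 1) * weight t s - 1)"
          by (simp add: sum_subtractf sum_distrib_left)
        also have "\<dots> \<le> (\<Sum>s\<in>X. real (floor_weight m i (length s)))"
        proof (rule sum_mono)
          fix s
          have "real (m + 1) * weight t s \<le> real (m + 1) * weight (real i / real (m + 1)) s"
            using ti t assms by (intro mult_left_mono weight_mono) auto
          then show "real (m + 1) * weight t s - 1 \<le> real (floor_weight m i (length s))"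
            unfolding floor_weight_eq[OF i] by linarith
        qed
        also have "\<dots> \<le> (\<Sum>s\<in>?A m. real (floor_weight m i (length s)))"
          using elim(1) by (intro sum_mono2 finite_codes_less) auto
        also have "\<dots> = real (lower_sum F m i)" by (simp add: lower_sum_eq)
        also have "\<dots> \<le> f m * real (m + 1)" using that by (simp add: below_iff divide_simps add.commute)
        finally have "sum (weight t) X \<le> f m + real (card X) / (real m + 1)"
          by (simp add: field_simps)
        with elim(2) show False by simp
      qed
      \<comment> \<open>The accepted \<open>i\<close> are naturals below \<open>t * (m + 1)\<close>,
        so the ceiling bounds their number; this is the source of the \<open>+ 1\<close>.\<close>
      have "i < nat \<lceil>t * (real m + 1)\<rceil>" if "below i m" for i
        using less[OF that] by linarith
      then have "{i. i < m + 1 \<and> below i m} \<subseteq> {..<nat \<lceil>t * (real m + 1)\<rceil>}"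
        by blast
      then have "cnt m \<le> card {..<nat \<lceil>t * (real m + 1)\<rceil>}"
        unfolding cnt_card by (intro card_mono) auto
      moreover have "0 \<le> t * (real m + 1)" using t assms by simp
      ultimately show ?case by simp linarith
    qed
  qed
  have "(\<lambda>m. real (cnt m) / (real m + 1)) \<longlonglongrightarrow> T"
  proof (rule order_tendstoI)
    fix l assume "l < T"
    have "T < real (cnt m) / (real m + 1)" if "1 \<le> m" for m
      using lower[OF that] by (simp add: divide_simps)
    then show "\<forall>\<^sub>F m in sequentially. l < real (cnt m) / (real m + 1)"
      using \<open>l < T\<close> by (intro eventually_sequentiallyI[of 1]) (force intro: less_trans)
  next
    fix u assume "T < u"
    \<comment> \<open>The midpoint leaves room for the error \<open>1 / (m + 1)\<close>.\<close>
    define t where "t = (T + u) / 2"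
    have t: "T < t" "t < u" using \<open>T < u\<close> by (auto simp: t_def)
    have "(\<lambda>m. t + 1 / (real m + 1)) \<longlonglongrightarrow> t + 0"
      by (intro tendsto_add tendsto_const const_over_Suc_tendsto_0)
    then have "\<forall>\<^sub>F m in sequentially. t + 1 / (real m + 1) < u"
      using t by (intro order_tendstoD(2)) auto
    with upper[OF t(1)] show "\<forall>\<^sub>F m in sequentially. real (cnt m) / (real m + 1) < u"
    proof eventually_elim
      case (elim m)
      have "real (cnt m) / (real m + 1) \<le> (t * (real m + 1) + 1) / (real m + 1)"
        using elim(1) by (intro divide_right_mono) auto
      also have "\<dots> = t + 1 / (real m + 1)" by (simp add: add_divide_distrib)
      finally have "real (cnt m) / (real m + 1) \<le> t + 1 / (real m + 1)" .
      with elim(2) show ?case by simp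
    qed
  qed
  \<comment> \<open>The approximations to \<open>T\<close> are \<open>(cnt m - 0) / (m + 1)\<close>,
    in the format of \<open>right_computable\<close>.\<close>
  moreover have "total_recursive (\<lambda>_. 0)" "total_recursive (\<lambda>m. m)"
    unfolding total_recursive_iff_recfn by (auto intro: recfn_const recfn_nth)
  moreover have "T \<le> real (cnt m) / (real m + 1)" if "1 \<le> m" for m
    using lower[OF that] by (simp add: divide_simps)
  ultimately show ?thesis
    unfolding right_computable_def Let_def using total
    by (intro exI[of _ cnt] exI[of _ "\<lambda>_. 0"] exI[of _ "\<lambda>m. m"]) auto
qed

end
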